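(* Let $f,g\in H^1(\mathbb{D})$ satisfy $|f|=|g|$ almost everywhere on $\mathbb{T}$ (in the sense of radial limits) and on $r\mathbb{T}$ for some $0<r<1$. Then $f=\lambda g$ for some $\lambda\in\mathbb{T}$.
   Context: $\mathbb{D}$ is the open unit disc, $\mathbb{T}$ the unit circle, $r\mathbb{T}=\{z:|z|=r\}$, and $H^1(\mathbb{D})$ is the Hardy space of analytic functions on $\mathbb{D}$ with $\sup_{0<\rho<1}\int_0^{2\pi}|f(\rho e^{it})|\,dt<\infty$. *)

theory Defs
  imports "HOL-Complex_Analysis.Complex_Analysis"
begin

definition H1 :: "(complex \<Rightarrow> complex) set" where
  "H1 = {f. f holomorphic_on ball 0 1 \<and>
           bdd_above ((\<lambda>\<rho>. integral {0..2*pi} (\<lambda>t. cmod (f (complex_of_real \<rho> * cis t)))) ` {0<..<1})}"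

definition radial_limit :: "(complex \<Rightarrow> complex) \<Rightarrow> real \<Rightarrow> complex \<Rightarrow> bool" where
  "radial_limit f t a \<longleftrightarrow> ((\<lambda>\<rho>. f (complex_of_real \<rho> * cis t)) \<longlongrightarrow> a) (at_left 1)"

end

theory Submission
  imports Defs
begin

text \<open>
  On the disc of radius \<open>r\<close> the zeros of \<open>f\<close> and \<open>g\<close> can be traded for Blaschke factors,
  which have modulus 1 on \<open>rT\<close>; what is left are zero-free functions of equal modulus on
  \<open>rT\<close>, hence proportional. So \<open>f / g\<close> is a rational function \<open>p / q\<close>, and
  \<open>|p| = |q|\<close> on \<open>rT\<close>. If \<open>|p| \<noteq> |q|\<close> somewhere on \<open>T\<close>, then the radial limits of \<open>g\<close>
  vanish almost everywhere on an arc, which Jensen's inequality and Fatou's lemma (applied to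
  the negative part of \<open>ln |g|\<close> on circles of radius tending to 1) rule out. Reflection in
  both circles then shows that \<open>p / q\<close> is invariant under a dilation, and such a rational
  function is constant.
\<close>

section \<open>Polynomials of equal modulus on two circles\<close>

text \<open>With the powers of \<open>X\<close> split off as \<open>a\<close> and \<open>b\<close>,
  both sides carry \<open>X ^ (a + b)\<close>. Cancelling it and evaluating at 0, where neither
  cofactor vanishes, leaves \<open>s ^ b = s ^ a\<close>, and powers of \<open>s > 1\<close> are
  injective in the exponent.\<close>

lemma dilation_identity_order_eq:
  fixes A B :: "complex poly" and s :: real
  assumes "A \<noteq> 0" "B \<noteq> 0" "1 < s"
    and eq: "\<And>z::complex. poly A z * poly B (s * z) = poly A (s * z) * poly B z"
  shows "order 0 A = order 0 B"
proof -
  define X :: "complex poly" where "X = [:0, 1:]"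
  define S where "S = [:0, complex_of_real s:]"
  define a b where "a = order 0 A" and "b = order 0 B"
  have X0: "X \<noteq> 0" by (simp add: X_def)
  obtain A1 where A1: "A = X ^ a * A1" "\<not> X dvd A1"
    using order_decomp[OF \<open>A \<noteq> 0\<close>, of 0] by (auto simp: a_def X_def)
  obtain B1 where B1: "B = X ^ b * B1" "\<not> X dvd B1"
    using order_decomp[OF \<open>B \<noteq> 0\<close>, of 0] by (auto simp: b_def X_def)
  have nz: "poly A1 0 \<noteq> 0" "poly B1 0 \<noteq> 0"
    using A1(2) B1(2) poly_eq_0_iff_dvd[of A1 0] poly_eq_0_iff_dvd[of B1 0]
    by (simp_all add: X_def)
  have "poly (X ^ (a + b) * smult (of_real s ^ b) (A1 * pcompose B1 S)) z =
        poly (X ^ (a + b) * smult (of_real s ^ a) (pcompose A1 S * B1)) z" for z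
    using eq[of z] unfolding A1(1) B1(1)
    by (simp add: X_def S_def poly_pcompose power_add power_mult_distrib mult_ac)
  then have "X ^ (a + b) * smult (of_real s ^ b) (A1 * pcompose B1 S) =
             X ^ (a + b) * smult (of_real s ^ a) (pcompose A1 S * B1)"
    by (metis poly_eq_poly_eq_iff ext)
  then have "smult (of_real s ^ b) (A1 * pcompose B1 S) =
             smult (of_real s ^ a) (pcompose A1 S * B1)"
    using mult_left_cancel[of "X ^ (a + b)"] X0 power_not_zero by blast
  then have "poly (smult (of_real s ^ b) (A1 * pcompose B1 S)) 0 =
             poly (smult (of_real s ^ a) (pcompose A1 S * B1)) 0"
    by simp
  then have "complex_of_real (s ^ b) = of_real (s ^ a)"
    using nz by (simp add: S_def poly_pcompose)
  then show ?thesis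
    using \<open>1 < s\<close> power_inject_exp[of s b a] unfolding a_def b_def of_real_eq_iff by simp
qed

text \<open>The identity says that \<open>A / B\<close> is invariant under dilation by
  \<open>s\<close>. It is linear in \<open>A\<close>, so \<open>A - smult c B\<close> satisfies it
  too and, if nonzero, has the same order at 0 as \<open>B\<close>. Choosing \<open>c\<close> to
  cancel the lowest coefficient raises that order, so the difference must be zero.\<close>

lemma dilation_identity_proportional:
  fixes A B :: "complex poly" and s :: real
  assumes "A \<noteq> 0" "B \<noteq> 0" "1 < s"
    and eq: "\<And>z::complex. poly A z * poly B (s * z) = poly A (s * z) * poly B z"
  obtains c where "A = smult c B"
proof -
  define X :: "complex poly" where "X = [:0, 1:]"
  define n where "n = order 0 B"
  have n: "order 0 A = n"
    using dilation_identity_order_eq[OF assms] by (simp add: n_def)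
  obtain A1 where A1: "A = X ^ n * A1" "\<not> X dvd A1"
    using order_decomp[OF \<open>A \<noteq> 0\<close>, of 0] by (auto simp: n X_def)
  obtain B1 where B1: "B = X ^ n * B1" "\<not> X dvd B1"
    using order_decomp[OF \<open>B \<noteq> 0\<close>, of 0] by (auto simp: n_def X_def)
  have nz: "poly B1 0 \<noteq> 0"
    using B1(2) poly_eq_0_iff_dvd[of B1 0] by (simp add: X_def)
  define c where "c = poly A1 0 / poly B1 0"
  define C where "C = A - smult c B"
  define D where "D = A1 - smult c B1"
  have CD: "C = X ^ n * D"
    by (simp add: C_def D_def A1(1) B1(1) algebra_simps)
  have "C = 0"
  proof (rule ccontr)
    assume C: "C \<noteq> 0"
    have "poly C z * poly B (s * z) = poly C (s * z) * poly B z" for z :: complex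
      using eq[of z] by (simp add: C_def algebra_simps)
    from dilation_identity_order_eq[OF C \<open>B \<noteq> 0\<close> \<open>1 < s\<close> this]
    have "order 0 C = n" by (simp add: n_def)
    moreover have "order 0 C = n + order 0 D"
      using C order_power_n_n[of 0 n] unfolding CD by (subst order_mult) (simp_all add: X_def)
    moreover have "D \<noteq> 0" "poly D 0 = 0"
      using C CD nz by (auto simp: D_def c_def)
    ultimately show False
      using order_root[of D 0] by simp
  qed
  then show ?thesis
    using that[of c] by (simp add: C_def)
qed

text \<open>A circle is connected with more than one point, so it has no isolated points, and
  deleting a finite set leaves each of its points a limit point. This allows common zeros to be
  cancelled from equations between moduli.\<close>

lemma continuous_on_sphere_eq_off_finite:
  fixes u v :: "complex \<Rightarrow> real"
  assumes "0 < r" "continuous_on (sphere 0 r) u" "continuous_on (sphere 0 r) v"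
    and "finite X" and eq: "\<And>z. z \<in> sphere 0 r - X \<Longrightarrow> u z = v z"
    and z: "z \<in> sphere 0 r"
  shows "u z = v z"
proof -
  have "connected (sphere (0::complex) r)"
    by (intro connected_sphere) simp
  moreover have "\<not> (\<exists>a. sphere (0::complex) r = {a})"
  proof
    assume "\<exists>a. sphere (0::complex) r = {a}"
    moreover have "of_real r \<in> sphere (0::complex) r" "- of_real r \<in> sphere (0::complex) r"
      using \<open>0 < r\<close> by auto
    ultimately show False using \<open>0 < r\<close> by force
  qed
  ultimately have lim: "z islimpt sphere 0 r"
    using connected_imp_perfect z by blast
  have "z islimpt (sphere 0 r - X)"
    using lim islimpt_finite[OF \<open>finite X\<close>, of z] islimpt_Un[of z "sphere 0 r - X" X]
    by (metis Un_Diff_cancel2 islimpt_Un)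
  then have "at z within (sphere 0 r - X) \<noteq> bot"
    by (simp add: trivial_limit_within)
  moreover have "((\<lambda>w. u w - v w) \<longlongrightarrow> u z - v z) (at z within (sphere 0 r - X))"
    using assms(2,3) z
    by (intro tendsto_diff) (auto simp: continuous_on_def intro: tendsto_within_subset)
  moreover have "((\<lambda>w. u w - v w) \<longlongrightarrow> 0) (at z within (sphere 0 r - X))"
    by (rule tendsto_eventually) (auto simp: eventually_at_filter eq)
  ultimately have "u z - v z = 0"
    using tendsto_unique by blast
  then show ?thesis by simp
qed

text \<open>A finite circle could serve as its own exceptional set, and the constants 0 and 1 would
  then agree on it.\<close>

lemma infinite_sphere_complex:
  assumes "0 < r"
  shows "infinite (sphere (0::complex) r)"
proof
  assume f: "finite (sphere (0::complex) r)"
  have "(0::real) = 1"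
    by (rule continuous_on_sphere_eq_off_finite
        [OF assms _ _ f, of "\<lambda>_. 0" "\<lambda>_. 1" "of_real r"]) (use assms in auto)
  then show False by simp
qed

lemma poly_eq_if_eq_on_sphere:
  fixes P Q :: "complex poly"
  assumes "0 < r" "\<And>z. z \<in> sphere 0 r \<Longrightarrow> poly P z = poly Q z"
  shows "P = Q"
proof (rule ccontr)
  assume "P \<noteq> Q"
  then have fin: "finite {z. poly (P - Q) z = 0}"
    by (intro poly_roots_finite) simp
  then have "finite (sphere (0::complex) r)"
    by (rule finite_subset[rotated]) (use assms(2) in auto)
  then show False using infinite_sphere_complex[OF assms(1)] by blast
qed

text \<open>On the circle \<open>z / r\<^sup>2\<close> is the inverse of \<open>cnj z\<close>. Hence
  the conjugate of \<open>poly p z\<close>, which is not holomorphic in \<open>z\<close>, becomes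
  polynomial there after multiplication by a power.\<close>

lemma cnj_poly_eq_reflect:
  fixes p :: "complex poly"
  assumes "0 < r" "z \<in> sphere 0 r"
  shows "poly (reflect_poly (map_poly cnj p)) (z / r\<^sup>2) = (z / r\<^sup>2) ^ degree p * cnj (poly p z)"
proof -
  have z0: "z \<noteq> 0" using assms by auto
  have zz: "z * cnj z = of_real (r\<^sup>2)"
    using assms by (simp add: complex_norm_square[symmetric])
  have "inverse (z / complex_of_real (r\<^sup>2)) = cnj z"
    using zz z0 \<open>0 < r\<close> by (simp add: field_simps)
  moreover have "degree (map_poly cnj p) = degree p"
    by (rule degree_map_poly) simp
  ultimately show ?thesis
    using poly_reflect_poly_nz[of "z / r\<^sup>2" "map_poly cnj p"] z0 \<open>0 < r\<close> by simp
qed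

text \<open>Writing the squared modulus as a product with the conjugate and reflecting turns each
  hypothesis into a polynomial identity: \<open>p * A = q * B\<close> from the unit circle, and the
  same with \<open>A\<close> and \<open>B\<close> dilated by \<open>s\<close> from the other circle.
  Eliminating \<open>p\<close> and \<open>q\<close> shows that \<open>A / B\<close> is invariant
  under the dilation, hence constant.\<close>

lemma poly_norm_eq_on_two_circles:
  fixes p q :: "complex poly" and r :: real
  assumes "p \<noteq> 0" "q \<noteq> 0" "0 < r" "r < 1"
    and 1: "\<And>z. z \<in> sphere 0 1 \<Longrightarrow> norm (poly p z) = norm (poly q z)"
    and r: "\<And>z. z \<in> sphere 0 r \<Longrightarrow> norm (poly p z) = norm (poly q z)"
  obtains c where "norm c = 1" "q = smult c p"
proof -
  define s where "s = 1 / r\<^sup>2"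
  have s: "1 < s"
    using \<open>0 < r\<close> \<open>r < 1\<close> by (simp add: s_def power_less_one_iff)
  define X :: "complex poly" where "X = [:0, 1:]"
  \<comment> \<open>The extra powers of \<open>X\<close> balance the degrees: with them both sides
    of \<open>circle\<close> carry the same factor, the power of \<open>z / t\<^sup>2\<close> with
    exponent \<open>degree p + degree q\<close>.\<close>
  define A where "A = reflect_poly (map_poly cnj p) * X ^ degree q"
  define B where "B = reflect_poly (map_poly cnj q) * X ^ degree p"
  have nz: "A \<noteq> 0" "B \<noteq> 0"
    using assms(1,2) by (simp_all add: A_def B_def X_def map_poly_eq_0_iff)
  have circle: "poly p z * poly A (z / t\<^sup>2) = poly q z * poly B (z / t\<^sup>2)"
    if t: "0 < t" "z \<in> sphere 0 t" and n: "norm (poly p z) = norm (poly q z)" for t z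
  proof -
    have "poly p z * cnj (poly p z) = poly q z * cnj (poly q z)"
      using n by (simp add: complex_norm_square[symmetric])
    then show ?thesis
      using cnj_poly_eq_reflect[OF t] by (simp add: A_def B_def X_def algebra_simps)
  qed
  have pA: "p * A = q * B"
    by (rule poly_eq_if_eq_on_sphere[of 1]) (use circle[of 1] 1 in auto)
  have pA_s: "p * pcompose A [:0, of_real s:] = q * pcompose B [:0, of_real s:]"
    by (rule poly_eq_if_eq_on_sphere[OF \<open>0 < r\<close>])
      (use circle[OF \<open>0 < r\<close>] r in \<open>auto simp: poly_pcompose s_def\<close>)
  \<comment> \<open>The two identities are multiplied crosswise, the left side of one with the right
    side of the other.\<close>
  have "p * q * (A * pcompose B [:0, of_real s:]) = p * q * (pcompose A [:0, of_real s:] * B)"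
    using pA pA_s by (metis (no_types, lifting) mult.assoc mult.commute)
  then have "A * pcompose B [:0, of_real s:] = pcompose A [:0, of_real s:] * B"
    using assms(1,2) by simp
  from arg_cong[OF this, of "\<lambda>P. poly P z" for z]
  have "poly A z * poly B (s * z) = poly A (s * z) * poly B z" for z :: complex
    by (simp add: poly_pcompose mult.commute)
  then obtain c where c: "A = smult c B"
    using dilation_identity_proportional[OF nz s] by blast
  have "smult c p * B = q * B"
    using pA c by simp
  then have q: "q = smult c p"
    using nz(2) by (metis mult_right_cancel)
  moreover have "norm c = 1"
  proof -
    obtain z where z: "z \<in> sphere 0 1" "poly p z \<noteq> 0"
      using poly_eq_if_eq_on_sphere[of 1 p 0] \<open>p \<noteq> 0\<close> by auto
    then show ?thesis
      using 1[OF z(1)] by (simp add: q norm_mult)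
  qed
  ultimately show ?thesis
    using that by blast
qed

section \<open>Equal modulus on one circle: the quotient is rational\<close>

text \<open>The local factor near \<open>a\<close> and the quotient of \<open>f\<close> by the
  power, holomorphic away from \<open>a\<close>, agree where both are defined and glue to a function
  on all of \<open>S\<close>.\<close>

lemma holomorphic_factor_zero_global:
  assumes "f holomorphic_on S" "open S" "connected S" "a \<in> S" "f a = 0"
    and "\<not> f constant_on S"
  obtains n F where "0 < n" "F holomorphic_on S" "F a \<noteq> 0"
    "\<And>z. z \<in> S \<Longrightarrow> f z = (z - a) ^ n * F z"
proof -
  obtain g r n where g: "0 < n" "0 < r" "ball a r \<subseteq> S" "g holomorphic_on ball a r"
    "\<And>w. w \<in> ball a r \<Longrightarrow> f w = (w - a) ^ n * g w" "\<And>w. w \<in> ball a r \<Longrightarrow> g w \<noteq> 0"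
    using holomorphic_factor_zero_nonconstant[OF assms] by metis
  define F where "F = (\<lambda>z. if z = a then g a else f z / (z - a) ^ n)"
  have "F holomorphic_on ball a r"
    by (rule holomorphic_transform[OF g(4)]) (use g in \<open>auto simp: F_def\<close>)
  moreover have "(\<lambda>z. f z / (z - a) ^ n) holomorphic_on S - {a}"
    by (intro holomorphic_intros holomorphic_on_subset[OF assms(1)]) auto
  then have "F holomorphic_on S - {a}"
    by (rule holomorphic_transform) (auto simp: F_def)
  ultimately have "F holomorphic_on ball a r \<union> (S - {a})"
    using \<open>open S\<close> by (intro holomorphic_on_Un) auto
  moreover have "ball a r \<union> (S - {a}) = S"
    using g(2,3) \<open>a \<in> S\<close> by auto
  ultimately have "F holomorphic_on S" by simp
  moreover have "F a \<noteq> 0"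
    using g by (simp add: F_def)
  moreover have "f z = (z - a) ^ n * F z" if "z \<in> S" for z
    using \<open>f a = 0\<close> \<open>0 < n\<close> by (simp add: F_def)
  ultimately show ?thesis
    using that g(1) by blast
qed

text \<open>Induction on the number of zeros in \<open>K\<close>, which is finite because
  \<open>f\<close> is not constant once it has a zero: splitting off one zero to its full order
  removes it from the count. The multiset records multiplicities; \<open>F\<close> may still vanish
  in \<open>S\<close> outside \<open>K\<close>.\<close>

lemma holomorphic_factor_zeros_compact:
  assumes "f holomorphic_on S" "open S" "connected S" "compact K" "K \<subseteq> S"
    and "w \<in> S" "f w \<noteq> 0"
  obtains M F where "set_mset M \<subseteq> K" "F holomorphic_on S" "\<And>z. z \<in> K \<Longrightarrow> F z \<noteq> 0"
    "\<And>z. z \<in> S \<Longrightarrow> f z = (\<Prod>a\<in>#M. z - a) * F z"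
proof -
  have "\<exists>M F. set_mset M \<subseteq> K \<and> F holomorphic_on S \<and> (\<forall>z\<in>K. F z \<noteq> 0) \<and>
          (\<forall>z\<in>S. f z = (\<Prod>a\<in>#M. z - a) * F z)"
    using assms(1,7)
  proof (induction "card {z\<in>K. f z = 0}" arbitrary: f rule: less_induct)
    case less
    show ?case
    proof (cases "\<exists>a\<in>K. f a = 0")
      case False
      then show ?thesis
        using less.prems by (intro exI[of _ "{#}"] exI[of _ f]) auto
    next
      case True
      then obtain a where a: "a \<in> K" "f a = 0" by blast
      then have "a \<in> S" using \<open>K \<subseteq> S\<close> by blast
      have nc: "\<not> f constant_on S"
        using a \<open>a \<in> S\<close> \<open>w \<in> S\<close> less.prems(2) by (metis constant_on_def)
      obtain n F where F: "0 < n" "F holomorphic_on S" "F a \<noteq> 0"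
        "\<And>z. z \<in> S \<Longrightarrow> f z = (z - a) ^ n * F z"
        using holomorphic_factor_zero_global[OF less.prems(1) assms(2,3) \<open>a \<in> S\<close> a(2) nc] by metis
      have fin: "finite {z\<in>K. f z = 0}"
        using holomorphic_compact_finite_zeros[OF less.prems(1) assms(2-5) nc] .
      have "{z\<in>K. F z = 0} \<subset> {z\<in>K. f z = 0}"
        using F a \<open>K \<subseteq> S\<close> by auto
      then have "card {z\<in>K. F z = 0} < card {z\<in>K. f z = 0}"
        using fin by (rule psubset_card_mono[rotated])
      moreover have "F w \<noteq> 0"
        using F(4)[OF \<open>w \<in> S\<close>] less.prems(2) by auto
      ultimately obtain M G where G: "set_mset M \<subseteq> K" "G holomorphic_on S"
        "\<forall>z\<in>K. G z \<noteq> 0" "\<forall>z\<in>S. F z = (\<Prod>a\<in>#M. z - a) * G z"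
        using less.hyps[OF _ F(2)] by metis
      show ?thesis
        using G F a
        by (intro exI[of _ "replicate_mset n a + M"] exI[of _ G]) (auto simp: mult.assoc)
    qed
  qed
  then show ?thesis using that by metis
qed

text \<open>On the circle \<open>r\<^sup>2\<close> equals \<open>z * cnj z\<close>, so the numerator
  is \<open>z * cnj (z - a)\<close>. For \<open>a\<close> inside the circle, \<open>z - a\<close>
  divided by this factor is the Blaschke factor of the disc of radius \<open>r\<close>.\<close>

lemma norm_reflected_factor:
  assumes "z \<in> sphere 0 r" "0 < r"
  shows "norm ((of_real (r\<^sup>2) - cnj a * z) / of_real r) = norm (z - a)"
proof -
  have "z * cnj z = of_real (r\<^sup>2)"
    using assms by (simp add: complex_norm_square[symmetric])
  then have "of_real (r\<^sup>2) - cnj a * z = z * cnj (z - a)"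
    by (simp add: algebra_simps)
  then have "norm (of_real (r\<^sup>2) - cnj a * z) = r * norm (z - a)"
    using assms(1) by (simp only: norm_mult complex_mod_cnj) simp
  then show ?thesis
    using \<open>0 < r\<close> by (simp add: norm_divide)
qed

text \<open>For nonzero \<open>a\<close> the only zero is the mirror image of \<open>a\<close> in
  the circle, which lies outside the closed disc.\<close>

lemma reflected_factor_nonzero:
  assumes "norm a < r" "norm z \<le> r"
  shows "(of_real (r\<^sup>2) - cnj a * z) / of_real r \<noteq> 0"
proof
  assume *: "(of_real (r\<^sup>2) - cnj a * z) / of_real r = (0::complex)"
  have "0 < r" using assms(1) by (meson norm_ge_zero order_le_less_trans)
  with * have "cnj a * z = of_real (r\<^sup>2)" by simp
  then have "norm a * norm z = r\<^sup>2"
    by (metis complex_mod_cnj norm_mult norm_of_real abs_of_nonneg zero_le_power2)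
  moreover have "norm a * norm z < r * r"
  proof -
    have "norm a * norm z \<le> norm a * r"
      using assms by (intro mult_left_mono) auto
    also have "\<dots> < r * r" using assms(1) \<open>0 < r\<close> by simp
    finally show ?thesis .
  qed
  ultimately show False by (simp add: power2_eq_square)
qed

text \<open>The maximum modulus principle for \<open>F / G\<close> and for \<open>G / F\<close>
  gives modulus 1 on the whole closed disc, so the maximum is attained in the interior and the
  quotient is constant.\<close>

lemma zero_free_norm_eq_on_sphere:
  assumes "F holomorphic_on S" "G holomorphic_on S" "open S" "connected S" "cball 0 r \<subseteq> S" "0 < r"
    and "\<And>z. z \<in> cball 0 r \<Longrightarrow> F z \<noteq> 0" "\<And>z. z \<in> cball 0 r \<Longrightarrow> G z \<noteq> 0"
    and "\<And>z. z \<in> sphere 0 r \<Longrightarrow> norm (F z) = norm (G z)"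
  obtains c where "c \<noteq> 0" "\<And>z. z \<in> S \<Longrightarrow> F z = c * G z"
proof -
  have hol: "F holomorphic_on cball 0 r" "G holomorphic_on cball 0 r"
    using assms(1,2,5) holomorphic_on_subset by blast+
  have le: "norm (U z / V z) \<le> 1"
    if "U holomorphic_on cball 0 r" "V holomorphic_on cball 0 r"
      and nz: "\<And>z. z \<in> cball 0 r \<Longrightarrow> V z \<noteq> 0"
      and sph: "\<And>z. z \<in> sphere 0 r \<Longrightarrow> norm (U z) = norm (V z)" and "z \<in> cball 0 r" for U V and z :: complex
  proof (rule maximum_modulus_frontier[of "\<lambda>z. U z / V z" "cball 0 r"])
    have *: "(\<lambda>z. U z / V z) holomorphic_on cball 0 r"
      using that by (intro holomorphic_intros) auto
    then show "(\<lambda>z. U z / V z) holomorphic_on interior (cball 0 r)"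
      by (rule holomorphic_on_subset) (rule interior_subset)
    show "continuous_on (closure (cball 0 r)) (\<lambda>z. U z / V z)"
      using holomorphic_on_imp_continuous_on[OF *] by simp
    show "norm (U z / V z) \<le> 1" if z: "z \<in> frontier (cball 0 r)" for z
    proof -
      have "z \<in> sphere 0 r" "z \<in> cball 0 r" using z \<open>0 < r\<close> by auto
      then show ?thesis using nz sph by (simp add: norm_divide)
    qed
  qed (use that in auto)
  have one: "norm (F z / G z) = 1" if "z \<in> cball 0 r" for z
  proof (rule antisym)
    show "norm (F z / G z) \<le> 1"
      using le[OF hol assms(8,9) that] by simp
    have "norm (G z / F z) \<le> 1"
      using le[OF hol(2,1) assms(7) _ that] assms(9) by simp
    then show "1 \<le> norm (F z / G z)"
      using assms(7,8)[OF that] by (simp add: norm_divide field_simps)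
  qed
  define c where "c = F 0 / G 0"
  have "(\<lambda>z. F z / G z) constant_on ball 0 r"
  proof (rule maximum_modulus_principle[of "\<lambda>z. F z / G z" "ball 0 r" "ball 0 r" 0])
    show "(\<lambda>z. F z / G z) holomorphic_on ball 0 r"
      using hol assms(8) by (intro holomorphic_intros) (auto intro: holomorphic_on_subset)
    show "norm (F z / G z) \<le> norm (F 0 / G 0)" if "z \<in> ball 0 r" for z
      using one[of z] one[of 0] that \<open>0 < r\<close> by auto
  qed (use \<open>0 < r\<close> in auto)
  then have "F z / G z = c" if "z \<in> ball 0 r" for z
    using that \<open>0 < r\<close> unfolding constant_on_def c_def by (metis centre_in_ball)
  then have eq_ball: "F z = c * G z" if "z \<in> ball 0 r" for z
    using assms(8)[of z] that by (metis ball_subset_cball nonzero_divide_eq_eq subsetD)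
  \<comment> \<open>Outside the closed disc \<open>G\<close> may vanish, so the identity is
    continued in product form.\<close>
  have "F z = c * G z" if "z \<in> S" for z
    by (rule analytic_continuation_open[of "ball 0 r" S])
      (use assms that eq_ball in \<open>auto intro!: holomorphic_intros\<close>)
  moreover have "c \<noteq> 0"
    using assms(6) assms(7)[of 0] assms(8)[of 0] by (simp add: c_def)
  ultimately show ?thesis using that by blast
qed

text \<open>Induction on the number of linear factors. A factor with its zero inside the disc is
  traded for the reflected factor, which joins the zero-free part; a zero on the circle occurs on
  both sides and cancels; with no factors left the zero-free parts are proportional. Each trade
  multiplies \<open>p\<close> and \<open>q\<close> by a linear factor or a nonzero constant.\<close>

lemma norm_eq_on_sphere_imp_rational_factored:
  fixes M N :: "complex multiset"
  assumes "open S" "connected S" "cball 0 r \<subseteq> S" "0 < r"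
    and "set_mset M \<subseteq> cball 0 r" "set_mset N \<subseteq> cball 0 r"
    and "F holomorphic_on S" "G holomorphic_on S"
    and "\<And>z. z \<in> cball 0 r \<Longrightarrow> F z \<noteq> 0" "\<And>z. z \<in> cball 0 r \<Longrightarrow> G z \<noteq> 0"
    and "\<And>z. z \<in> sphere 0 r \<Longrightarrow>
           norm ((\<Prod>a\<in>#M. z - a) * F z) = norm ((\<Prod>a\<in>#N. z - a) * G z)"
  shows "\<exists>p q. p \<noteq> 0 \<and> q \<noteq> 0 \<and>
           (\<forall>z\<in>S. ((\<Prod>a\<in>#M. z - a) * F z) * poly q z = ((\<Prod>a\<in>#N. z - a) * G z) * poly p z)"
  using assms(5-)
proof (induction "size M + size N" arbitrary: M N F G rule: less_induct)
  case less
  define refl where "refl = (\<lambda>a z. (of_real (r\<^sup>2) - cnj a * z) / complex_of_real r)"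
  have refl_hol: "(\<lambda>z. refl a z * H z) holomorphic_on S" if "H holomorphic_on S" for a H
    using that \<open>0 < r\<close> by (auto simp: refl_def intro!: holomorphic_intros)
  have refl_norm: "norm (refl a z) = norm (z - a)" if "z \<in> sphere 0 r" for a z
    using norm_reflected_factor[OF that \<open>0 < r\<close>] by (simp add: refl_def)
  have refl_nz: "refl a z \<noteq> 0" if "norm a < r" "z \<in> cball 0 r" for a z
    using reflected_factor_nonzero[of a r z] that by (simp add: refl_def)
  have refl_poly: "poly [:of_real r, - cnj a / of_real r:] z = refl a z" for a z
    using \<open>0 < r\<close> by (simp add: refl_def field_simps power2_eq_square)
  have poly_nz: "[:of_real r, - cnj a / of_real r:] \<noteq> 0" for a
    using \<open>0 < r\<close> by simp
  consider (M) a where "a \<in># M" "norm a < r" | (N) a where "a \<in># N" "norm a < r"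
    | (both) a where "a \<in># M \<or> a \<in># N" "norm a = r" | (none) "M = {#}" "N = {#}"
    using less.prems(1,2) by (metis mem_cball_0 multiset_nonemptyE order_le_less subsetD)
  then show ?case
  proof cases
    case (M a)
    then obtain M' where M': "M = add_mset a M'" by (meson multi_member_split)
    have "\<exists>p q. p \<noteq> 0 \<and> q \<noteq> 0 \<and> (\<forall>z\<in>S. ((\<Prod>a\<in>#M'. z - a) * (refl a z * F z)) * poly q z =
              ((\<Prod>a\<in>#N. z - a) * G z) * poly p z)"
    proof (rule less.hyps[of M' N "\<lambda>z. refl a z * F z" G])
      show "norm ((\<Prod>a\<in>#M'. z - a) * (refl a z * F z)) = norm ((\<Prod>a\<in>#N. z - a) * G z)"
        if "z \<in> sphere 0 r" for z
        using less.prems(7)[OF that] refl_norm[OF that] by (simp add: M' norm_mult mult_ac)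
    qed (use less.prems refl_hol refl_nz M M' in auto)
    then obtain p q where pq: "p \<noteq> 0" "q \<noteq> 0"
      "\<And>z. z \<in> S \<Longrightarrow> ((\<Prod>a\<in>#M'. z - a) * (refl a z * F z)) * poly q z =
              ((\<Prod>a\<in>#N. z - a) * G z) * poly p z" by blast
    show ?thesis
    proof (intro exI conjI ballI)
      show "[:-a, 1:] * p \<noteq> 0" "[:of_real r, - cnj a / of_real r:] * q \<noteq> 0"
        using pq(1,2) poly_nz by (auto simp del: mult_pCons_left)
      fix z assume "z \<in> S"
      then show "((\<Prod>a\<in>#M. z - a) * F z) * poly ([:of_real r, - cnj a / of_real r:] * q) z =
                 ((\<Prod>a\<in>#N. z - a) * G z) * poly ([:-a, 1:] * p) z"
        using arg_cong[OF pq(3)[OF \<open>z \<in> S\<close>], of "\<lambda>x. (z - a) * x"]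
        unfolding poly_mult refl_poly by (simp add: M' mult_ac)
    qed
  next
    case (N a)
    then obtain N' where N': "N = add_mset a N'" by (meson multi_member_split)
    have "\<exists>p q. p \<noteq> 0 \<and> q \<noteq> 0 \<and> (\<forall>z\<in>S. ((\<Prod>a\<in>#M. z - a) * F z) * poly q z =
              ((\<Prod>a\<in>#N'. z - a) * (refl a z * G z)) * poly p z)"
    proof (rule less.hyps[of M N' F "\<lambda>z. refl a z * G z"])
      show "norm ((\<Prod>a\<in>#M. z - a) * F z) = norm ((\<Prod>a\<in>#N'. z - a) * (refl a z * G z))"
        if "z \<in> sphere 0 r" for z
        using less.prems(7)[OF that] refl_norm[OF that] by (simp add: N' norm_mult mult_ac)
    qed (use less.prems refl_hol refl_nz N N' in auto)
    then obtain p q where pq: "p \<noteq> 0" "q \<noteq> 0"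
      "\<And>z. z \<in> S \<Longrightarrow> ((\<Prod>a\<in>#M. z - a) * F z) * poly q z =
              ((\<Prod>a\<in>#N'. z - a) * (refl a z * G z)) * poly p z" by blast
    show ?thesis
    proof (intro exI conjI ballI)
      show "[:of_real r, - cnj a / of_real r:] * p \<noteq> 0" "[:-a, 1:] * q \<noteq> 0"
        using pq(1,2) poly_nz by (auto simp del: mult_pCons_left)
      fix z assume "z \<in> S"
      then show "((\<Prod>a\<in>#M. z - a) * F z) * poly ([:-a, 1:] * q) z =
                 ((\<Prod>a\<in>#N. z - a) * G z) * poly ([:of_real r, - cnj a / of_real r:] * p) z"
        using arg_cong[OF pq(3)[OF \<open>z \<in> S\<close>], of "\<lambda>x. (z - a) * x"]
        unfolding poly_mult refl_poly by (simp add: N' mult_ac)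
    qed
  next
    case (both a)
    have a: "a \<in> sphere 0 r" "a \<in> cball 0 r" using both by auto
    have zero_iff: "(\<Prod>x\<in>#L. a - x) = 0 \<longleftrightarrow> a \<in># L" for L
      by (auto simp: prod_mset_zero_iff image_iff)
    \<comment> \<open>\<open>F\<close> and \<open>G\<close> do not vanish at \<open>a\<close>, so
      equality of moduli there makes both products vanish or neither.\<close>
    have "a \<in># M \<longleftrightarrow> a \<in># N"
      using less.prems(7)[OF a(1)] less.prems(5,6)[OF a(2)] zero_iff
      by (metis mult_eq_0_iff norm_eq_zero)
    with both have "a \<in># M" "a \<in># N" by auto
    then obtain M' N' where MN: "M = add_mset a M'" "N = add_mset a N'"
      by (meson multi_member_split)
    have cont: "continuous_on (sphere 0 r) (\<lambda>z. norm ((\<Prod>x\<in>#L. z - x) * H z))"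
      if "H holomorphic_on S" for L H
    proof -
      have "continuous_on (sphere 0 r) H"
        using that \<open>cball 0 r \<subseteq> S\<close>
        by (meson continuous_on_subset holomorphic_on_imp_continuous_on sphere_cball subset_trans)
      moreover have "continuous_on (sphere 0 r) (\<lambda>z. \<Prod>x\<in>#L. z - x)"
        by (induction L) (auto intro!: continuous_intros)
      ultimately show ?thesis by (intro continuous_intros)
    qed
    have "\<exists>p q. p \<noteq> 0 \<and> q \<noteq> 0 \<and> (\<forall>z\<in>S. ((\<Prod>a\<in>#M'. z - a) * F z) * poly q z =
              ((\<Prod>a\<in>#N'. z - a) * G z) * poly p z)"
    proof (rule less.hyps[of M' N' F G])
      show "norm ((\<Prod>a\<in>#M'. z - a) * F z) = norm ((\<Prod>a\<in>#N'. z - a) * G z)"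
        if "z \<in> sphere 0 r" for z
      \<comment> \<open>The common factor \<open>z - a\<close> cancels everywhere except at
        \<open>a\<close>; continuity supplies that point.\<close>
      proof (rule continuous_on_sphere_eq_off_finite[OF \<open>0 < r\<close> cont cont, of _ _ "{a}"])
        show "norm ((\<Prod>a\<in>#M'. z - a) * F z) = norm ((\<Prod>a\<in>#N'. z - a) * G z)"
          if "z \<in> sphere 0 r - {a}" for z
          using less.prems(7)[of z] that by (auto simp: MN norm_mult)
      qed (use less.prems that in auto)
    qed (use less.prems MN in auto)
    then show ?thesis
      by (simp add: MN mult.assoc) metis
  next
    case none
    then obtain c where c: "c \<noteq> 0" "\<And>z. z \<in> S \<Longrightarrow> F z = c * G z"
      using zero_free_norm_eq_on_sphere[OF less.prems(3,4) assms(1-4) less.prems(5,6)]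
        less.prems(7) by auto
    then show ?thesis
      using none by (intro exI[of _ "[:c:]"] exI[of _ 1]) auto
  qed
qed

lemma norm_eq_on_sphere_imp_rational:
  assumes "f holomorphic_on S" "g holomorphic_on S" "open S" "connected S" "cball 0 r \<subseteq> S" "0 < r"
    and "u \<in> S" "f u \<noteq> 0" "v \<in> S" "g v \<noteq> 0"
    and "\<And>z. z \<in> sphere 0 r \<Longrightarrow> norm (f z) = norm (g z)"
  obtains p q where "p \<noteq> 0" "q \<noteq> 0" "\<And>z. z \<in> S \<Longrightarrow> f z * poly q z = g z * poly p z"
proof -
  obtain M F where F: "set_mset M \<subseteq> cball 0 r" "F holomorphic_on S"
    "\<And>z. z \<in> cball 0 r \<Longrightarrow> F z \<noteq> 0" "\<And>z. z \<in> S \<Longrightarrow> f z = (\<Prod>a\<in>#M. z - a) * F z"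
    using holomorphic_factor_zeros_compact[OF assms(1,3,4) compact_cball assms(5,7,8)] by metis
  obtain N G where G: "set_mset N \<subseteq> cball 0 r" "G holomorphic_on S"
    "\<And>z. z \<in> cball 0 r \<Longrightarrow> G z \<noteq> 0" "\<And>z. z \<in> S \<Longrightarrow> g z = (\<Prod>a\<in>#N. z - a) * G z"
    using holomorphic_factor_zeros_compact[OF assms(2,3,4) compact_cball assms(5,9,10)] by metis
  have "norm ((\<Prod>a\<in>#M. z - a) * F z) = norm ((\<Prod>a\<in>#N. z - a) * G z)" if "z \<in> sphere 0 r" for z
    using assms(11)[OF that] F(4)[of z] G(4)[of z] that assms(5) by auto
  from norm_eq_on_sphere_imp_rational_factored[OF assms(3-6) F(1) G(1) F(2) G(2) F(3) G(3) this]
  show ?thesis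
    using that F(4) G(4) by auto
qed

section \<open>Jensen's inequality and boundary uniqueness\<close>

text \<open>On a slightly larger disc \<open>G\<close> is still zero-free and so has a holomorphic
  logarithm \<open>L\<close>. Cauchy's formula for \<open>L\<close> at the centre gives the mean
  value property, and \<open>ln (norm (G z))\<close> is the real part of \<open>L z\<close>.\<close>

lemma mean_value_ln_norm_zero_free:
  assumes "G holomorphic_on S" "open S" "cball 0 \<rho> \<subseteq> S" "0 < \<rho>"
    and nz: "\<And>z. z \<in> cball 0 \<rho> \<Longrightarrow> G z \<noteq> 0"
  shows "((\<lambda>t. ln (norm (G (of_real \<rho> * cis t)))) has_integral 2 * pi * ln (norm (G 0))) {0..2*pi}"
proof -
  define U where "U = {z \<in> S. G z \<noteq> 0}"
  have "open U"
    using continuous_open_preimage[OF holomorphic_on_imp_continuous_on[OF assms(1)] assms(2), of "- {0}"]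
    by (simp add: U_def vimage_def Int_def open_Compl)
  have "cball 0 \<rho> \<subseteq> U"
    using assms(3) nz by (auto simp: U_def)
  then obtain e where e: "0 < e" "(\<Union>x\<in>cball 0 \<rho>. ball x e) \<subseteq> U"
    using compact_subset_open_imp_ball_epsilon_subset[OF compact_cball \<open>open U\<close>] by blast
  have sub: "ball 0 (\<rho> + e) \<subseteq> U"
  proof
    fix z :: complex assume z: "z \<in> ball 0 (\<rho> + e)"
    show "z \<in> U"
    proof (cases "norm z \<le> \<rho>")
      case True
      then show ?thesis using \<open>cball 0 \<rho> \<subseteq> U\<close> by auto
    next
      case False
      \<comment> \<open>The radial projection of \<open>z\<close> to the circle, at distance
        \<open>norm z - \<rho> < e\<close> from \<open>z\<close>.\<close>
      define x where "x = (\<rho> / norm z) *\<^sub>R z"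
      have "norm z > 0" using False \<open>0 < \<rho>\<close> by linarith
      then have x: "x \<in> cball 0 \<rho>"
        using \<open>0 < \<rho>\<close> by (simp add: x_def)
      have "z - x = (1 - \<rho> / norm z) *\<^sub>R z"
        by (simp add: x_def algebra_simps)
      then have "norm (z - x) = \<bar>1 - \<rho> / norm z\<bar> * norm z"
        by (simp only: norm_scaleR)
      also have "\<dots> = (1 - \<rho> / norm z) * norm z"
        using False \<open>norm z > 0\<close> by simp
      also have "\<dots> = norm z - \<rho>"
        using \<open>norm z > 0\<close> by (simp add: algebra_simps)
      finally have "norm (z - x) = norm z - \<rho>" .
      then have "z \<in> ball x e"
        using z by (simp add: dist_norm norm_minus_commute)
      then show ?thesis using e(2) x by blast
    qed
  qed
  have hol: "G holomorphic_on ball 0 (\<rho> + e)"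
    using assms(1) sub by (auto simp: U_def intro: holomorphic_on_subset)
  obtain L where L: "L holomorphic_on ball 0 (\<rho> + e)" "\<And>z. z \<in> ball 0 (\<rho> + e) \<Longrightarrow> exp (L z) = G z"
  proof (rule holomorphic_logarithm_exists[OF convex_ball open_ball hol, of 0])
    show "G z \<noteq> 0" if "z \<in> ball 0 (\<rho> + e)" for z
      using that sub by (auto simp: U_def)
  qed (use e(1) \<open>0 < \<rho>\<close> in auto)
  have ln_G: "ln (norm (G z)) = Re (L z)" if "z \<in> cball 0 \<rho>" for z
    using L(2)[of z] that e(1) by (auto simp flip: L(2))
  have "L holomorphic_on cball 0 \<rho>"
    by (rule holomorphic_on_subset[OF L(1)]) (use e(1) in auto)
  then have "((\<lambda>u. L u / (u - 0)) has_contour_integral (2 * of_real pi * \<i> * L 0)) (circlepath 0 \<rho>)"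
    using \<open>0 < \<rho>\<close> by (intro Cauchy_integral_circlepath_simple) auto
  then have "((\<lambda>t. L (0 + of_real \<rho> * cis t) / (0 + of_real \<rho> * cis t - 0) * of_real \<rho> * \<i> * cis t)
      has_integral (2 * of_real pi * \<i> * L 0)) {0..2*pi}"
    unfolding circlepath_def by (subst (asm) has_contour_integral_part_circlepath_iff) auto
  also have "(\<lambda>t. L (0 + of_real \<rho> * cis t) / (0 + of_real \<rho> * cis t - 0) * of_real \<rho> * \<i> * cis t) =
      (\<lambda>t. \<i> * L (of_real \<rho> * cis t))"
    using \<open>0 < \<rho>\<close> by (auto simp: field_simps)
  \<comment> \<open>Multiplying by minus the imaginary unit removes the factor left by the
    derivative of the path.\<close>
  finally have "((\<lambda>t. - \<i> * (\<i> * L (of_real \<rho> * cis t)))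
      has_integral (- \<i> * (2 * of_real pi * \<i> * L 0))) {0..2*pi}"
    by (rule has_integral_mult_right)
  moreover have "- \<i> * (\<i> * x) = x" "- \<i> * (2 * of_real pi * \<i> * x) = of_real (2 * pi) * x" for x
    by (simp_all add: complex_eq_iff)
  ultimately have "((\<lambda>t. L (of_real \<rho> * cis t)) has_integral (of_real (2 * pi) * L 0)) {0..2*pi}"
    by (simp only:)
  from has_integral_linear[OF this bounded_linear_Re]
  have "((\<lambda>t. Re (L (of_real \<rho> * cis t))) has_integral 2 * pi * Re (L 0)) {0..2*pi}"
    by (simp add: o_def)
  then show ?thesis
    using ln_G \<open>0 < \<rho>\<close> by (simp add: norm_mult)
qed

text \<open>Trading each factor \<open>z - a\<close> for its reflection gives a zero-free
  \<open>G\<close> with the same modulus on the circle, to which the mean value property applies. At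
  0 each factor's modulus changes from \<open>norm a\<close> to the larger \<open>\<rho>\<close>, so
  \<open>norm (G 0)\<close> dominates \<open>norm (g 0)\<close>.\<close>

lemma jensen_inequality:
  assumes "g holomorphic_on S" "open S" "connected S" "cball 0 \<rho> \<subseteq> S" "0 < \<rho>" "g 0 \<noteq> 0"
    and nz: "\<And>z. z \<in> sphere 0 \<rho> \<Longrightarrow> g z \<noteq> 0"
  shows "2 * pi * ln (norm (g 0)) \<le> integral {0..2*pi} (\<lambda>t. ln (norm (g (of_real \<rho> * cis t))))"
proof -
  have "0 \<in> S" using assms(4,5) by auto
  then obtain M F where F: "set_mset M \<subseteq> cball 0 \<rho>" "F holomorphic_on S"
    "\<And>z. z \<in> cball 0 \<rho> \<Longrightarrow> F z \<noteq> 0" "\<And>z. z \<in> S \<Longrightarrow> g z = (\<Prod>a\<in>#M. z - a) * F z"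
    using holomorphic_factor_zeros_compact[OF assms(1-3) compact_cball assms(4) _ assms(6)] by metis
  have M: "norm a < \<rho>" if "a \<in># M" for a
  proof -
    have "norm a \<le> \<rho>" using F(1) that by auto
    moreover have "norm a \<noteq> \<rho>"
    proof
      assume a: "norm a = \<rho>"
      then have "a \<in> S" using assms(4) by auto
      then have "g a = 0"
        using F(4) that by (auto simp: prod_mset_zero_iff image_iff)
      then show False using nz[of a] a by simp
    qed
    ultimately show ?thesis by simp
  qed
  define P where "P = (\<lambda>L z. \<Prod>a\<in>#L. (of_real (\<rho>\<^sup>2) - cnj a * z) / complex_of_real \<rho>)"
  define G where "G = (\<lambda>z. P M z * F z)"
  have P_hol: "P L holomorphic_on S" for L
    unfolding P_def using \<open>0 < \<rho>\<close> by (induction L) (auto intro!: holomorphic_intros)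
  have P_norm: "norm (P L z) = norm (\<Prod>a\<in>#L. z - a)" if "z \<in> sphere 0 \<rho>" for L z
    using norm_reflected_factor[OF that \<open>0 < \<rho>\<close>, symmetric]
    by (induction L) (simp_all add: P_def norm_mult norm_divide)
  have "G holomorphic_on S"
    unfolding G_def using P_hol F(2) by (intro holomorphic_intros)
  moreover have G_nz: "G z \<noteq> 0" if "z \<in> cball 0 \<rho>" for z
  proof -
    have "(0::complex) \<noteq> (of_real (\<rho>\<^sup>2) - cnj a * z) / of_real \<rho>" if "a \<in># M" for a
      using reflected_factor_nonzero[OF M[OF that], of z] \<open>z \<in> cball 0 \<rho>\<close> by simp
    then have "P M z \<noteq> 0"
      unfolding P_def prod_mset_zero_iff set_image_mset by blast
    then show ?thesis using F(3)[OF that] by (simp add: G_def)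
  qed
  ultimately have "((\<lambda>t. ln (norm (G (of_real \<rho> * cis t)))) has_integral 2 * pi * ln (norm (G 0))) {0..2*pi}"
    using mean_value_ln_norm_zero_free[of G S \<rho>] assms(2,4,5) by blast
  moreover have "norm (G z) = norm (g z)" if "z \<in> sphere 0 \<rho>" for z
    using that P_norm[OF that] F(4)[of z] assms(4) by (auto simp: G_def norm_mult)
  ultimately have "((\<lambda>t. ln (norm (g (of_real \<rho> * cis t)))) has_integral 2 * pi * ln (norm (G 0))) {0..2*pi}"
    using \<open>0 < \<rho>\<close> by (simp add: norm_mult)
  moreover have "norm (g 0) \<le> norm (G 0)"
  proof -
    have "norm (\<Prod>a\<in>#L. 0 - a) \<le> norm (P L 0)" if "set_mset L \<subseteq> cball 0 \<rho>" for L
      using that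
    proof (induction L)
      case (add a L)
      have "norm a * norm (\<Prod>a\<in>#L. 0 - a) \<le> \<rho> * norm (P L 0)"
        using add \<open>0 < \<rho>\<close> by (intro mult_mono) auto
      then show ?case
        using \<open>0 < \<rho>\<close> by (simp add: P_def norm_mult norm_divide power2_eq_square)
    qed (simp add: P_def)
    from this[OF F(1)] show ?thesis
      using F(4)[OF \<open>0 \<in> S\<close>] by (simp add: G_def norm_mult mult_right_mono)
  qed
  then have "ln (norm (g 0)) \<le> ln (norm (G 0))"
    using \<open>g 0 \<noteq> 0\<close> G_nz[of 0] \<open>0 < \<rho>\<close> by (subst ln_le_cancel_iff) auto
  ultimately show ?thesis
    by (simp add: integral_unique)
qed

text \<open>As \<open>g\<close> may vanish at 0, a power of \<open>z\<close> is split off before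
  Jensen's inequality is applied. On a circle of radius \<open>\<rho>\<close> that power contributes
  \<open>2 * pi * n * ln \<rho>\<close>, and \<open>1/2 \<le> \<rho>\<close> makes the bound uniform
  in \<open>\<rho>\<close>.\<close>

lemma ln_norm_integral_lower_bound:
  assumes "g holomorphic_on ball 0 1" "w \<in> ball 0 1" "g w \<noteq> 0"
  obtains C where "\<And>\<rho>. \<lbrakk>1/2 \<le> \<rho>; \<rho> < 1; \<And>z. z \<in> sphere 0 \<rho> \<Longrightarrow> g z \<noteq> 0\<rbrakk> \<Longrightarrow>
    C \<le> integral {0..2*pi} (\<lambda>t. ln (norm (g (of_real \<rho> * cis t))))"
proof -
  obtain n G where G: "G holomorphic_on ball 0 1" "G 0 \<noteq> 0" "\<And>z. z \<in> ball 0 1 \<Longrightarrow> g z = z ^ n * G z"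
  proof (cases "g 0 = 0")
    case False
    then show ?thesis using that[of g 0] assms by simp
  next
    case True
    then have "\<not> g constant_on ball 0 1"
      using assms(2,3) by (metis centre_in_ball constant_on_def zero_less_one)
    then obtain n F where F: "F holomorphic_on ball 0 1" "F 0 \<noteq> 0"
      "\<And>z. z \<in> ball 0 1 \<Longrightarrow> g z = (z - 0) ^ n * F z"
      using holomorphic_factor_zero_global[OF assms(1) open_ball connected_ball, of 0] True
      by (metis centre_in_ball zero_less_one)
    then show ?thesis using that[OF F(1,2), of n] by simp
  qed
  show ?thesis
  proof (rule that)
    fix \<rho> :: real
    assume \<rho>: "1/2 \<le> \<rho>" "\<rho> < 1" and nz: "\<And>z. z \<in> sphere 0 \<rho> \<Longrightarrow> g z \<noteq> 0"
    have in_ball: "of_real \<rho> * cis t \<in> ball 0 1" "of_real \<rho> * cis t \<in> sphere 0 \<rho>" for t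
      using \<rho> by (auto simp: norm_mult)
    have G_nz: "G z \<noteq> 0" if "z \<in> sphere 0 \<rho>" for z
      using nz[OF that] G(3)[of z] that \<rho> by auto
    have jensen: "2 * pi * ln (norm (G 0)) \<le> integral {0..2*pi} (\<lambda>t. ln (norm (G (of_real \<rho> * cis t))))"
      by (rule jensen_inequality[OF G(1)]) (use \<rho> G(2) G_nz in auto)
    have eq: "ln (norm (g (of_real \<rho> * cis t))) = n * ln \<rho> + ln (norm (G (of_real \<rho> * cis t)))" for t
      using G(3)[OF in_ball(1)] G_nz[OF in_ball(2)] \<rho>
      by (simp add: norm_mult norm_power ln_mult ln_realpow)
    have "continuous_on UNIV (\<lambda>t. G (of_real \<rho> * cis t))"
      by (rule continuous_on_compose2[OF holomorphic_on_imp_continuous_on[OF G(1)]])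
         (use in_ball in \<open>auto intro!: continuous_intros\<close>)
    then have "continuous_on UNIV (\<lambda>t. ln (norm (G (of_real \<rho> * cis t))))"
      using G_nz[OF in_ball(2)] by (intro continuous_intros) auto
    then have int: "(\<lambda>t. ln (norm (G (of_real \<rho> * cis t)))) integrable_on {0..2*pi}"
      by (intro integrable_continuous_interval) (auto intro: continuous_on_subset)
    have "ln (1/2) \<le> ln \<rho>" using \<rho> by (subst ln_le_cancel_iff) auto
    then have "2 * pi * n * ln (1/2) \<le> 2 * pi * n * ln \<rho>"
      by (intro mult_left_mono) auto
    with jensen have "2 * pi * n * ln (1/2) + 2 * pi * ln (norm (G 0)) \<le>
        2 * pi * n * ln \<rho> + integral {0..2*pi} (\<lambda>t. ln (norm (G (of_real \<rho> * cis t))))"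
      by (rule add_mono[rotated])
    then show "2 * pi * n * ln (1/2) + 2 * pi * ln (norm (G 0)) \<le>
        integral {0..2*pi} (\<lambda>t. ln (norm (g (of_real \<rho> * cis t))))"
      unfolding eq by (subst integral_add) (use int in \<open>auto simp: mult_ac\<close>)
  qed
qed

lemma holomorphic_finite_zeros_compact:
  assumes "f holomorphic_on S" "open S" "connected S" "w \<in> S" "f w \<noteq> 0" "compact K" "K \<subseteq> S"
  shows "finite {z\<in>K. f z = 0}"
proof (cases "f constant_on S")
  case True
  then have "f z \<noteq> 0" if "z \<in> S" for z
    using assms(4,5) that by (metis constant_on_def)
  then have empty: "{z\<in>K. f z = 0} = {}" using assms(7) by auto
  show ?thesis unfolding empty by simp
next
  case False
  then show ?thesis
    using holomorphic_compact_finite_zeros assms by blast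
qed

text \<open>Zeros in a smaller closed disc have only finitely many moduli, so some radius in the
  interval avoids them all. Such circles are the ones on which the lower bound for the logarithmic
  integral is available.\<close>

lemma ex_zero_free_circle:
  assumes "g holomorphic_on ball 0 1" "w \<in> ball 0 1" "g w \<noteq> 0" "l < 1" "0 \<le> l"
  shows "\<exists>\<rho>. l < \<rho> \<and> \<rho> < 1 \<and> (\<forall>z\<in>sphere 0 \<rho>. g z \<noteq> 0)"
proof -
  define m where "m = (l + 1) / 2"
  have m: "l < m" "m < 1" using \<open>l < 1\<close> by (simp_all add: m_def)
  have "finite {z\<in>cball 0 m. g z = 0}"
    by (rule holomorphic_finite_zeros_compact[OF assms(1) open_ball connected_ball assms(2,3)])
       (use m in auto)
  then have "finite (norm ` {z\<in>cball 0 m. g z = 0})" by simp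
  moreover have "infinite {l<..<m}" using m by (simp add: infinite_Ioo)
  ultimately obtain \<rho> where "\<rho> \<in> {l<..<m}" "\<rho> \<notin> norm ` {z\<in>cball 0 m. g z = 0}"
    by (meson finite_subset subsetI)
  then show ?thesis
    using m by (intro exI[of _ \<rho>]) auto
qed

text \<open>For \<open>g\<close> not identically zero, the \<open>H1\<close> bound \<open>B\<close>
  and the logarithmic bound \<open>C\<close> together bound the integrals of the negative part of
  \<open>ln (norm g)\<close> over circles tending to the boundary. On \<open>E\<close> these
  negative parts tend to infinity almost everywhere, which Fatou's lemma forbids on a set of
  positive measure.\<close>

lemma H1_boundary_uniqueness:
  assumes "g \<in> H1" and E: "E \<in> sets borel" "E \<subseteq> {0..2*pi}" "emeasure lborel E \<noteq> 0"
    and rad: "AE t in lborel. t \<in> E \<longrightarrow> radial_limit g t 0"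
    and "z \<in> ball 0 1"
  shows "g z = 0"
proof (rule ccontr)
  assume "g z \<noteq> 0"
  have hol: "g holomorphic_on ball 0 1" using \<open>g \<in> H1\<close> by (simp add: H1_def)
  obtain B where B: "\<And>\<rho>. 0 < \<rho> \<Longrightarrow> \<rho> < 1 \<Longrightarrow>
      integral {0..2*pi} (\<lambda>t. norm (g (of_real \<rho> * cis t))) \<le> B"
    using \<open>g \<in> H1\<close> by (force simp: H1_def bdd_above_def)
  obtain C where C: "\<And>\<rho>. \<lbrakk>1/2 \<le> \<rho>; \<rho> < 1; \<And>z. z \<in> sphere 0 \<rho> \<Longrightarrow> g z \<noteq> 0\<rbrakk> \<Longrightarrow>
      C \<le> integral {0..2*pi} (\<lambda>t. ln (norm (g (of_real \<rho> * cis t))))"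
    using ln_norm_integral_lower_bound[OF hol \<open>z \<in> ball 0 1\<close> \<open>g z \<noteq> 0\<close>] by metis
  \<comment> \<open>The shift by 2 keeps every radius above \<open>1/2\<close>, the range in which
    \<open>C\<close> is valid.\<close>
  have "\<exists>\<rho>. 1 - 1 / (real n + 2) < \<rho> \<and> \<rho> < 1 \<and> (\<forall>z\<in>sphere 0 \<rho>. g z \<noteq> 0)" for n
    by (rule ex_zero_free_circle[OF hol \<open>z \<in> ball 0 1\<close> \<open>g z \<noteq> 0\<close>]) auto
  then obtain \<rho> where \<rho>: "\<And>n. 1 - 1 / (real n + 2) < \<rho> n" "\<And>n. \<rho> n < 1"
      "\<And>n z. z \<in> sphere 0 (\<rho> n) \<Longrightarrow> g z \<noteq> 0"
    by metis
  have half: "1/2 \<le> \<rho> n" for n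
  proof -
    have "1 / (real n + 2) \<le> 1 / 2" by (intro divide_left_mono) auto
    then show ?thesis using \<rho>(1)[of n] by linarith
  qed
  have "\<rho> \<longlonglongrightarrow> 1"
  proof (rule tendsto_sandwich)
    show "(\<lambda>n. 1 - 1 / (real n + 2)) \<longlonglongrightarrow> 1" by real_asymp
    show "\<forall>\<^sub>F n in sequentially. 1 - 1 / (real n + 2) \<le> \<rho> n" "\<forall>\<^sub>F n in sequentially. \<rho> n \<le> 1"
      using \<rho>(1,2) by (auto intro!: always_eventually less_imp_le)
  qed auto
  then have \<rho>_lim: "filterlim \<rho> (at_left 1) sequentially"
    using \<rho>(2) by (auto simp: filterlim_at intro!: always_eventually less_imp_neq)
  define c where "c = (\<lambda>n t. of_real (\<rho> n) * cis t)"
  have c: "c n t \<in> ball 0 1" "c n t \<in> sphere 0 (\<rho> n)" for n t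
    using \<rho>(2)[of n] half[of n] by (auto simp: c_def norm_mult)
  define \<phi> where "\<phi> = (\<lambda>n t. max 0 (- ln (norm (g (c n t)))))"
  have cont_g: "continuous_on UNIV (\<lambda>t. g (c n t))" for n
    by (rule continuous_on_compose2[OF holomorphic_on_imp_continuous_on[OF hol]])
       (use c in \<open>auto simp: c_def intro!: continuous_intros\<close>)
  have cont_ln: "continuous_on UNIV (\<lambda>t. ln (norm (g (c n t))))" for n
    using cont_g \<rho>(3)[OF c(2)] by (intro continuous_intros) auto
  have cont: "continuous_on UNIV (\<phi> n)" for n
    unfolding \<phi>_def using cont_ln[of n]
    by (intro continuous_on_max continuous_on_minus continuous_on_const)
  have int: "u integrable_on {0..2*pi}" if "continuous_on UNIV u" for u :: "real \<Rightarrow> real"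
    using that by (intro integrable_continuous_interval) (auto intro: continuous_on_subset)
  have bound: "integral {0..2*pi} (\<phi> n) \<le> B - C" for n
  proof -
    have "integral {0..2*pi} (\<phi> n) \<le>
          integral {0..2*pi} (\<lambda>t. norm (g (c n t)) - ln (norm (g (c n t))))"
    proof (rule integral_le)
      \<comment> \<open>The negative part of \<open>ln x\<close> is its positive part minus
        \<open>ln x\<close>, and the positive part is at most \<open>x\<close>.\<close>
      show "\<phi> n t \<le> norm (g (c n t)) - ln (norm (g (c n t)))" for t
        using ln_bound[of "norm (g (c n t))"] \<rho>(3)[OF c(2)[of n t]] by (auto simp: \<phi>_def)
    qed (use cont cont_g cont_ln in
        \<open>auto intro!: int continuous_on_diff continuous_on_norm\<close>)
    also have "\<dots> = integral {0..2*pi} (\<lambda>t. norm (g (c n t))) -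
                     integral {0..2*pi} (\<lambda>t. ln (norm (g (c n t))))"
      by (rule integral_diff) (use cont_g cont_ln in \<open>auto intro!: int continuous_on_norm\<close>)
    also have "\<dots> \<le> B - C"
      using B[of "\<rho> n"] C[of "\<rho> n"] half[of n] \<rho>(2)[of n] \<rho>(3)[of _ n]
      unfolding c_def by (intro diff_mono) auto
    finally show ?thesis .
  qed
  define \<psi> where "\<psi> = (\<lambda>n t. ennreal (if t \<in> {0..2*pi} then \<phi> n t else 0))"
  have meas_\<phi>: "\<phi> n \<in> borel_measurable borel" for n
    using cont by (rule borel_measurable_continuous_onI)
  have nn: "integral\<^sup>N lborel (\<psi> n) \<le> ennreal (B - C)" for n
  proof -
    have "integral\<^sup>N lborel (\<psi> n) = ennreal (integral {0..2*pi} (\<phi> n))"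
      unfolding \<psi>_def
    proof (rule nn_integral_has_integral_lborel)
      show "((\<lambda>t. if t \<in> {0..2*pi} then \<phi> n t else 0) has_integral integral {0..2*pi} (\<phi> n)) UNIV"
        unfolding has_integral_restrict_UNIV using int[OF cont] by (rule integrable_integral)
      show "(\<lambda>t. if t \<in> {0..2*pi} then \<phi> n t else 0) \<in> borel_measurable borel"
        using meas_\<phi>[of n] by (intro measurable_If_set) auto
    qed (auto simp: \<phi>_def)
    also have "\<dots> \<le> ennreal (B - C)"
      using bound by (rule ennreal_leI)
    finally show ?thesis .
  qed
  have "(\<integral>\<^sup>+t. top * indicator E t \<partial>lborel) \<le> (\<integral>\<^sup>+t. liminf (\<lambda>n. \<psi> n t) \<partial>lborel)"
  proof (rule nn_integral_mono_AE, use rad in \<open>rule eventually_mono\<close>)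
    fix t assume t: "t \<in> E \<longrightarrow> radial_limit g t 0"
    show "top * indicator E t \<le> liminf (\<lambda>n. \<psi> n t)"
    proof (cases "t \<in> E")
      case True
      with t have "((\<lambda>s. g (of_real s * cis t)) \<longlongrightarrow> 0) (at_left 1)"
        by (simp add: radial_limit_def)
      from filterlim_compose[OF this \<rho>_lim] have "(\<lambda>n. g (c n t)) \<longlonglongrightarrow> 0"
        by (simp add: c_def)
      \<comment> \<open>The circles avoid the zeros of \<open>g\<close>, so the norms approach 0
        through positive values and their logarithms tend to minus infinity.\<close>
      then have "filterlim (\<lambda>n. norm (g (c n t))) (at_right 0) sequentially"
        using \<rho>(3)[OF c(2)] by (auto simp: filterlim_at tendsto_norm_zero)
      from filterlim_compose[OF ln_at_0 this]
      have "filterlim (\<lambda>n. - ln (norm (g (c n t)))) at_top sequentially"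
        by (simp add: filterlim_uminus_at_bot)
      then have "filterlim (\<lambda>n. \<phi> n t) at_top sequentially"
        by (rule filterlim_at_top_mono) (auto simp: \<phi>_def)
      then have "(\<lambda>n. \<psi> n t) \<longlonglongrightarrow> top"
        using True E(2) by (auto simp: \<psi>_def ennreal_tendsto_top_eq_at_top)
      then have "liminf (\<lambda>n. \<psi> n t) = top"
        by (intro lim_imp_Liminf) auto
      then show ?thesis by simp
    qed simp
  qed
  also have "\<dots> \<le> liminf (\<lambda>n. integral\<^sup>N lborel (\<psi> n))"
    by (rule nn_integral_liminf) (use meas_\<phi> in \<open>auto simp: \<psi>_def\<close>)
  also have "\<dots> \<le> ennreal (B - C)"
    using nn by (intro Liminf_le) auto
  \<comment> \<open>The left side is \<open>top\<close> times the measure of \<open>E\<close>, hence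
    \<open>top\<close>, while the right side is finite.\<close>
  finally show False
    using E by (simp add: nn_integral_cmult_indicator top_unique)
qed

section \<open>Equality of moduli on two circles\<close>

lemma AE_lborel_ex_in_interval:
  fixes a b :: real
  assumes "AE t in lborel. P t" "a < b"
  obtains t where "a < t" "t < b" "P t"
proof -
  obtain N where N: "{t. \<not> P t} \<subseteq> N" "emeasure lborel N = 0" "N \<in> sets lborel"
    using AE_E[OF assms(1)] by auto
  have "\<not> {a<..<b} \<subseteq> N"
  proof
    assume "{a<..<b} \<subseteq> N"
    then have "emeasure lborel {a<..<b} \<le> emeasure lborel N"
      using N(3) by (intro emeasure_mono) auto
    then show False using N(2) \<open>a < b\<close> by simp
  qed
  then show ?thesis
    using N(1) that by (metis (no_types, lifting) greaterThanLessThan_iff mem_Collect_eq subset_iff)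
qed

lemma continuous_neq_interval:
  fixes u v :: "real \<Rightarrow> real"
  assumes "continuous_on UNIV u" "continuous_on UNIV v" "0 < t" "t < T" "u t \<noteq> v t"
  obtains a b where "0 \<le> a" "a < b" "b \<le> T" "\<And>s. a < s \<Longrightarrow> s < b \<Longrightarrow> u s \<noteq> v s"
proof -
  have "open {s. u s \<noteq> v s}"
    using assms(1,2) by (rule open_Collect_neq)
  then obtain e where e: "0 < e" "ball t e \<subseteq> {s. u s \<noteq> v s}"
    using openE[of "{s. u s \<noteq> v s}" t] assms(5) by blast
  show ?thesis
  proof
    show "u s \<noteq> v s" if "max 0 (t - e) < s" "s < min T (t + e)" for s
    proof -
      have "s \<in> ball t e" using that by (auto simp: dist_real_def)
      then show ?thesis using e(2) by blast
    qed
  qed (use e(1) assms(3,4) in auto)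
qed

text \<open>The open parameter interval misses only the point \<open>of_real r\<close>, a finite
  exceptional set.\<close>

lemma sphere_eq_if_eq_on_open_arc:
  fixes u v :: "complex \<Rightarrow> real"
  assumes "0 < r" "continuous_on (sphere 0 r) u" "continuous_on (sphere 0 r) v"
    and eq: "\<And>t. 0 < t \<Longrightarrow> t < 2*pi \<Longrightarrow> u (of_real r * cis t) = v (of_real r * cis t)"
    and "z \<in> sphere 0 r"
  shows "u z = v z"
proof (rule continuous_on_sphere_eq_off_finite[OF assms(1-3), of "{of_real r}"])
  fix z :: complex assume z: "z \<in> sphere 0 r - {of_real r}"
  define t where "t = Arg2pi z"
  have t: "0 \<le> t" "t < 2*pi" "z = of_real (norm z) * exp (\<i> * of_real t)"
    using Arg2pi[of z] by (auto simp: t_def is_Arg_def)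
  then have zt: "z = of_real r * cis t" using z by (simp add: cis_conv_exp)
  then have "t \<noteq> 0" using z by auto
  then show "u z = v z" using eq[of t] t zt by simp
qed (use assms in auto)

theorem theorem2p6:
  fixes f g :: "complex \<Rightarrow> complex" and r :: real
  assumes "f \<in> H1" and "g \<in> H1"
    and "AE t in lborel. t \<in> {0..2*pi} \<longrightarrow>
           (\<exists>a b. radial_limit f t a \<and> radial_limit g t b \<and> cmod a = cmod b)"
    and "0 < r" and "r < 1"
    and "AE t in lborel. t \<in> {0..2*pi} \<longrightarrow>
           cmod (f (complex_of_real r * cis t)) = cmod (g (complex_of_real r * cis t))"
  shows "\<exists>c. cmod c = 1 \<and> (\<forall>z\<in>ball 0 1. f z = c * g z)"
proof -
  have hol: "f holomorphic_on ball 0 1" "g holomorphic_on ball 0 1"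
    using assms(1,2) by (simp_all add: H1_def)
  have sub: "cball 0 r \<subseteq> ball (0::complex) 1" "sphere 0 r \<subseteq> ball (0::complex) 1"
    using \<open>r < 1\<close> by auto
  have on_circle: "of_real s * cis t \<in> sphere 0 s" if "0 < s" for s t :: real
    using that by (simp add: norm_mult)
  have cont_sphere: "continuous_on (sphere 0 r) (\<lambda>z. cmod (h z))" if "h holomorphic_on ball 0 1" for h
    by (intro continuous_on_norm holomorphic_on_imp_continuous_on holomorphic_on_subset[OF that sub(2)])
  have cont_t: "continuous_on UNIV (\<lambda>t. k (of_real s * cis t))"
    if "continuous_on (sphere 0 s) k" "0 < s" for k :: "complex \<Rightarrow> real" and s
    by (rule continuous_on_compose2[OF that(1)])
       (use on_circle[OF that(2)] in \<open>auto intro!: continuous_intros\<close>)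
  \<comment> \<open>By continuity a single failure would spread to an interval of parameters,
    against equality almost everywhere.\<close>
  have norm_eq: "cmod (f z) = cmod (g z)" if "z \<in> sphere 0 r" for z
  proof (rule sphere_eq_if_eq_on_open_arc[OF \<open>0 < r\<close> cont_sphere[OF hol(1)] cont_sphere[OF hol(2)] _ that])
    fix t :: real assume t: "0 < t" "t < 2*pi"
    show "cmod (f (of_real r * cis t)) = cmod (g (of_real r * cis t))"
    proof (rule ccontr)
      assume "cmod (f (of_real r * cis t)) \<noteq> cmod (g (of_real r * cis t))"
      then obtain a b where ab: "0 \<le> a" "a < b" "b \<le> 2*pi"
        "\<And>s. a < s \<Longrightarrow> s < b \<Longrightarrow> cmod (f (of_real r * cis s)) \<noteq> cmod (g (of_real r * cis s))"
        using continuous_neq_interval[OF cont_t[OF cont_sphere[OF hol(1)] \<open>0 < r\<close>]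
            cont_t[OF cont_sphere[OF hol(2)] \<open>0 < r\<close>] t] by metis
      obtain s where "a < s" "s < b" "s \<in> {0..2*pi} \<longrightarrow>
          cmod (f (of_real r * cis s)) = cmod (g (of_real r * cis s))"
        using AE_lborel_ex_in_interval[OF assms(6) ab(2)] by metis
      then show False using ab by auto
    qed
  qed
  have zero: "h z = 0" if "h holomorphic_on ball 0 1" "\<And>z. z \<in> sphere 0 r \<Longrightarrow> h z = 0" "z \<in> ball 0 1" for h z
  proof (rule ccontr)
    assume "h z \<noteq> 0"
    then have "finite {z \<in> sphere 0 r. h z = 0}"
      using holomorphic_finite_zeros_compact[OF that(1) open_ball connected_ball that(3) _ compact_sphere sub(2)]
      by blast
    moreover have "{z \<in> sphere 0 r. h z = 0} = sphere 0 r" using that(2) by blast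
    ultimately show False using infinite_sphere_complex[OF \<open>0 < r\<close>] by simp
  qed
  show ?thesis
  \<comment> \<open>If one function vanishes identically, both vanish on the inner circle and hence
    on the disc, and the constant 1 serves.\<close>
  proof (cases "(\<forall>z\<in>ball 0 1. f z = 0) \<or> (\<forall>z\<in>ball 0 1. g z = 0)")
    case True
    then have "(\<forall>z\<in>sphere 0 r. f z = 0) \<and> (\<forall>z\<in>sphere 0 r. g z = 0)"
      using norm_eq sub(2) by (metis norm_eq_zero subsetD)
    then have "f z = 0" "g z = 0" if "z \<in> ball 0 1" for z
      using zero[OF hol(1)] zero[OF hol(2)] that by blast+
    then show ?thesis by (intro exI[of _ 1]) auto
  next
    case False
    then obtain u v where uv: "u \<in> ball 0 1" "f u \<noteq> 0" "v \<in> ball 0 1" "g v \<noteq> 0" by blast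
    obtain p q where pq: "p \<noteq> 0" "q \<noteq> 0" "\<And>z. z \<in> ball 0 1 \<Longrightarrow> f z * poly q z = g z * poly p z"
      using norm_eq_on_sphere_imp_rational[OF hol open_ball connected_ball sub(1) \<open>0 < r\<close> uv norm_eq]
      by metis
    have cont_poly: "continuous_on S (\<lambda>z. cmod (poly k z))" for S and k :: "complex poly"
      by (intro continuous_intros)
    have norm_r: "cmod (poly p z) = cmod (poly q z)" if "z \<in> sphere 0 r" for z
    proof (rule continuous_on_sphere_eq_off_finite[OF \<open>0 < r\<close> cont_poly cont_poly _ _ that])
      show "finite {z \<in> sphere 0 r. g z = 0}"
        by (rule holomorphic_finite_zeros_compact[OF hol(2) open_ball connected_ball uv(3,4) compact_sphere sub(2)])
      fix z assume z: "z \<in> sphere 0 r - {z \<in> sphere 0 r. g z = 0}"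
      then have "cmod (f z) * cmod (poly q z) = cmod (g z) * cmod (poly p z)"
        using pq(3)[of z] sub(2) by (metis DiffD1 norm_mult subsetD)
      then show "cmod (poly p z) = cmod (poly q z)"
        using norm_eq[of z] z by auto
    qed
    \<comment> \<open>A failure would persist on an arc. There the limits \<open>x\<close> of
      \<open>f\<close> and \<open>y\<close> of \<open>g\<close> satisfy \<open>x * q = y * p\<close>
      with equal moduli, which forces \<open>y = 0\<close>, and boundary uniqueness then makes
      \<open>g\<close> vanish identically.\<close>
    have norm_1: "cmod (poly p z) = cmod (poly q z)" if "z \<in> sphere 0 1" for z
    proof (rule sphere_eq_if_eq_on_open_arc[OF zero_less_one cont_poly cont_poly _ that])
      fix t :: real assume t: "0 < t" "t < 2*pi"
      show "cmod (poly p (of_real 1 * cis t)) = cmod (poly q (of_real 1 * cis t))"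
      proof (rule ccontr)
        assume "cmod (poly p (of_real 1 * cis t)) \<noteq> cmod (poly q (of_real 1 * cis t))"
        then obtain a b where ab: "0 \<le> a" "a < b" "b \<le> 2*pi"
          "\<And>s. a < s \<Longrightarrow> s < b \<Longrightarrow> cmod (poly p (of_real 1 * cis s)) \<noteq> cmod (poly q (of_real 1 * cis s))"
          using continuous_neq_interval[OF cont_t[OF cont_poly zero_less_one]
              cont_t[OF cont_poly zero_less_one] t] by metis
        have "AE s in lborel. s \<in> {a<..<b} \<longrightarrow> radial_limit g s 0"
        proof (use assms(3) in \<open>rule eventually_mono\<close>, intro impI)
          fix s assume *: "s \<in> {0..2*pi} \<longrightarrow>
              (\<exists>a b. radial_limit f s a \<and> radial_limit g s b \<and> cmod a = cmod b)"
            and s: "s \<in> {a<..<b}"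
          then obtain x y where xy: "radial_limit f s x" "radial_limit g s y" "cmod x = cmod y"
            using ab by auto
          have "((\<lambda>\<rho>. of_real \<rho> * cis s) \<longlongrightarrow> of_real 1 * cis s) (at_left 1)"
            by (intro tendsto_intros)
          then have lim: "((\<lambda>\<rho>. poly k (of_real \<rho> * cis s)) \<longlongrightarrow> poly k (of_real 1 * cis s)) (at_left 1)" for k
            by (rule isCont_tendsto_compose[OF poly_isCont])
          have "((\<lambda>\<rho>. f (of_real \<rho> * cis s) * poly q (of_real \<rho> * cis s)) \<longlongrightarrow>
                  x * poly q (of_real 1 * cis s)) (at_left 1)"
            using xy(1) lim unfolding radial_limit_def by (intro tendsto_mult)
          moreover have "\<forall>\<^sub>F \<rho> in at_left 1. f (of_real \<rho> * cis s) * poly q (of_real \<rho> * cis s) =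
                  g (of_real \<rho> * cis s) * poly p (of_real \<rho> * cis s)"
            by (rule eventually_at_leftI[of 0]) (auto intro!: pq(3) simp: norm_mult)
          ultimately have lim1: "((\<lambda>\<rho>. g (of_real \<rho> * cis s) * poly p (of_real \<rho> * cis s)) \<longlongrightarrow>
                  x * poly q (of_real 1 * cis s)) (at_left 1)"
            by (rule Lim_transform_eventually)
          have lim2: "((\<lambda>\<rho>. g (of_real \<rho> * cis s) * poly p (of_real \<rho> * cis s)) \<longlongrightarrow>
                  y * poly p (of_real 1 * cis s)) (at_left 1)"
            using xy(2) lim unfolding radial_limit_def by (intro tendsto_mult)
          have "x * poly q (of_real 1 * cis s) = y * poly p (of_real 1 * cis s)"
            by (rule tendsto_unique[OF trivial_limit_at_left_real lim1 lim2])
          then have "cmod y * cmod (poly q (of_real 1 * cis s)) = cmod y * cmod (poly p (of_real 1 * cis s))"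
            using xy(3) by (metis norm_mult)
          then have "y = 0" using ab(4)[of s] s by auto
          then show "radial_limit g s 0" using xy(2) by simp
        qed
        then have "g v = 0"
          by (rule H1_boundary_uniqueness[OF assms(2), rotated 3]) (use ab uv(3) in auto)
        then show False using uv(4) by simp
      qed
    qed
    obtain c where c: "cmod c = 1" "q = smult c p"
      using poly_norm_eq_on_two_circles[OF pq(1,2) assms(4,5) norm_1 norm_r] by metis
    define R where "R = {z. poly p z = 0}"
    have fin: "finite R" unfolding R_def by (rule poly_roots_finite[OF pq(1)])
    \<comment> \<open>Since \<open>q = smult c p\<close>, the factor \<open>p\<close> cancels off
      its finitely many roots, and continuation covers the roots. The constant sought is therefore
      \<open>inverse c\<close>.\<close>
    have eq: "c * f z = g z" if "z \<in> ball 0 1" for z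
    proof (rule analytic_continuation_open[of "ball 0 1 - R" "ball 0 1" "\<lambda>z. c * f z" g])
      show "open (ball 0 1 - R)"
        using fin by (intro open_Diff finite_imp_closed) auto
      show "ball 0 1 - R \<noteq> {}"
      proof
        assume "ball 0 1 - R = {}"
        then have "sphere 0 r \<subseteq> R" using sub(2) by blast
        then show False
          using fin infinite_sphere_complex[OF \<open>0 < r\<close>] finite_subset by blast
      qed
      show "c * f z = g z" if "z \<in> ball 0 1 - R" for z
        using pq(3)[of z] that by (auto simp: c(2) R_def mult_ac)
    qed (use hol that in \<open>auto intro!: holomorphic_intros\<close>)
    have "c \<noteq> 0" using c(1) by auto
    then have "f z = inverse c * g z" if "z \<in> ball 0 1" for z
      using eq[OF that] by (simp add: field_simps)
    moreover have "cmod (inverse c) = 1" using c(1) by (simp add: norm_inverse)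
    ultimately show ?thesis by blast
  qed
qed

end
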